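(* For all natural numbers $p$ and $q$, $\mathcal{R}_1(p,q,1)=p+q-1$. In particular, for every natural number $n$, $\mathcal{R}_1(n,1)=2n-1$.
   Context: $T_n=n(n+1)/2$, $T_0=0$. A finite set $X\subseteq\mathbb{N}$ with $|X|=T_n$, enumerated $x_1<\dots<x_{T_n}$, has $i$-th level $\{x_{T_{i-1}+1},\dots,x_{T_i}\}$ for $1\le i\le n$; $\triangle_n$ is the set of all such sets. For such sets, $X\le Y$ means $X\subseteq Y$ and every level of $X$ is contained in a single level of $Y$, distinct levels of $X$ being contained in distinct levels of $Y$; $\triangle_k(B)=\{Z\in\triangle_k:Z\le B\}$. For natural numbers $k\le p,q$, a completed game of Mines$_m(p,q,k)$ is a partition $\triangle_k(B)=X\sqcup Y$, where $B\in\triangle_m$; it is a win for player one if there is $Z\in\triangle_p(B)$ with $\triangle_k(Z)\subseteq X$, a win for player two if there is $Z\in\triangle_q(B)$ with $\triangle_k(Z)\subseteq Y$, and a draw otherwise. The triangular Ramsey number $\mathcal{R}_1(p,q,k)$ is the least natural number $m\ge\max(p,q)$ such that no completed game of Mines$_m(p,q,k)$ is a draw; $\mathcal{R}_1(n,k)=\mathcal{R}_1(n,n,k)$. *)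

theory Defs
  imports Main
begin

definition triangular :: "nat \<Rightarrow> nat" where
  "triangular n = n * (n + 1) div 2"

definition triangles :: "nat \<Rightarrow> nat set set" where
  "triangles n = {X. finite X \<and> card X = triangular n}"

text \<open>The \<open>j\<close>-th smallest element of a finite set, counted from 1 (list positions start at 0).\<close>

definition elt :: "nat set \<Rightarrow> nat \<Rightarrow> nat" where
  "elt X j = sorted_list_of_set X ! (j - 1)"

definition level :: "nat set \<Rightarrow> nat \<Rightarrow> nat set" where
  "level X i = elt X ` {triangular (i - 1) + 1 .. triangular i}"

text \<open>For \<open>X \<in> triangles n\<close>, the bound \<open>triangular i \<le> card X\<close> says \<open>i \<le> n\<close>.\<close>

definition levels :: "nat set \<Rightarrow> nat set set" where
  "levels X = level X ` {i. 1 \<le> i \<and> triangular i \<le> card X}"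

definition tri_le :: "nat set \<Rightarrow> nat set \<Rightarrow> bool" where
  "tri_le X Y \<longleftrightarrow> X \<subseteq> Y \<and>
     (\<forall>L\<in>levels X. \<exists>M\<in>levels Y. L \<subseteq> M) \<and>
     (\<forall>L\<in>levels X. \<forall>L'\<in>levels X. \<forall>M\<in>levels Y. \<forall>M'\<in>levels Y.
        L \<noteq> L' \<longrightarrow> L \<subseteq> M \<longrightarrow> L' \<subseteq> M' \<longrightarrow> M \<noteq> M')"

definition triangles_in :: "nat \<Rightarrow> nat set \<Rightarrow> nat set set" where
  "triangles_in k B = {Z \<in> triangles k. tri_le Z B}"

definition completed_game ::
  "nat \<Rightarrow> nat \<Rightarrow> nat set \<Rightarrow> nat set set \<Rightarrow> nat set set \<Rightarrow> bool" where
  "completed_game m k B X Y \<longleftrightarrow>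
     B \<in> triangles m \<and> X \<union> Y = triangles_in k B \<and> X \<inter> Y = {}"

definition win_one :: "nat \<Rightarrow> nat \<Rightarrow> nat set \<Rightarrow> nat set set \<Rightarrow> bool" where
  "win_one p k B X \<longleftrightarrow> (\<exists>Z\<in>triangles_in p B. triangles_in k Z \<subseteq> X)"

definition win_two :: "nat \<Rightarrow> nat \<Rightarrow> nat set \<Rightarrow> nat set set \<Rightarrow> bool" where
  "win_two q k B Y \<longleftrightarrow> (\<exists>Z\<in>triangles_in q B. triangles_in k Z \<subseteq> Y)"

definition draw ::
  "nat \<Rightarrow> nat \<Rightarrow> nat \<Rightarrow> nat set \<Rightarrow> nat set set \<Rightarrow> nat set set \<Rightarrow> bool" where
  "draw p q k B X Y \<longleftrightarrow> \<not> win_one p k B X \<and> \<not> win_two q k B Y"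

text \<open>Meaningful only for \<open>k \<le> p\<close> and \<open>k \<le> q\<close>.\<close>

definition tri_ramsey :: "nat \<Rightarrow> nat \<Rightarrow> nat \<Rightarrow> nat" where
  "tri_ramsey p q k =
     (LEAST m. max p q \<le> m \<and> (\<forall>B X Y. completed_game m k B X Y \<longrightarrow> \<not> draw p q k B X Y))"

definition tri_ramsey_diag :: "nat \<Rightarrow> nat \<Rightarrow> nat" where
  "tri_ramsey_diag n k = tri_ramsey n n k"

end

theory Submission
  imports Defs
begin

text \<open>
  A completed game with \<open>k = 1\<close> is a two-colouring of the points of \<open>B\<close>. The last of the
  \<open>m = p + q - 1\<close> levels has \<open>p + q - 1\<close> points, hence \<open>p\<close> points of the first colour or \<open>q\<close>
  points of the second; these serve as the last level of the winning set, and the remaining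
  levels are found by induction in the first \<open>m - 1\<close> levels of \<open>B\<close>. Conversely, if
  \<open>m \<le> p + q - 2\<close>, colour \<open>p - 1\<close> whole levels with the first colour and the at most
  \<open>q - 1\<close> other levels with the second: distinct levels of a winning set would lie in distinct
  levels of \<open>B\<close> of the same colour.
\<close>

section \<open>Triangular numbers and the range of level indices\<close>

lemma triangular_0 [simp]: "triangular 0 = 0"
  by (simp add: triangular_def)

lemma triangular_Suc [simp]: "triangular (Suc n) = triangular n + Suc n"
  by (simp add: triangular_def)

lemma triangular_le_iff [simp]: "triangular i \<le> triangular n \<longleftrightarrow> i \<le> n"
proof -
  have "strict_mono triangular"
    by (simp add: strict_mono_Suc_iff)
  then show ?thesis
    by (rule strict_mono_less_eq)
qed

lemma levels_eq:
  assumes "X \<in> triangles n"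
  shows "levels X = level X ` {1..n}"
  using assms unfolding levels_def triangles_def by (auto simp: atLeastAtMost_def)

section \<open>Adding a new last level above a set\<close>

lemma sorted_list_of_set_Un:
  fixes A B :: "'a::linorder set"
  assumes "finite A" "finite B" "\<And>x y. x \<in> A \<Longrightarrow> y \<in> B \<Longrightarrow> x < y"
  shows "sorted_list_of_set (A \<union> B) = sorted_list_of_set A @ sorted_list_of_set B"
proof (rule sorted_distinct_set_unique)
  show "sorted (sorted_list_of_set A @ sorted_list_of_set B)"
    using assms by (auto simp: sorted_append less_imp_le)
  show "distinct (sorted_list_of_set A @ sorted_list_of_set B)"
    using assms by fastforce
qed (use assms in auto)

definition below :: "nat set \<Rightarrow> nat set \<Rightarrow> bool" where
  "below A B \<longleftrightarrow> (\<forall>x\<in>A. \<forall>y\<in>B. x < y)"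

lemma below_disjoint: "below A B \<Longrightarrow> A \<inter> B = {}"
  unfolding below_def by blast

lemma level_Un_low:
  assumes "Z \<in> triangles n" "finite S" "below Z S" "i \<in> {1..n}"
  shows "level (Z \<union> S) i = level Z i"
  unfolding level_def
proof (rule image_cong[OF refl])
  fix j assume j: "j \<in> {triangular (i - 1) + 1..triangular i}"
  \<comment> \<open>Levels up to \<open>n\<close> occupy only the first \<open>triangular n\<close>
    positions of the concatenated list, which belong to \<open>Z\<close>; \<open>j\<close> is at
    least 1, so \<open>j - 1\<close> is not truncated.\<close>
  have "j \<le> triangular n"
    by (rule order_trans[of _ "triangular i"]) (use j assms(4) in auto)
  then have "j - 1 < card Z"
    using j assms(1) by (auto simp: triangles_def)
  then show "elt (Z \<union> S) j = elt Z j"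
    using assms(1-3)
    by (simp add: elt_def sorted_list_of_set_Un triangles_def below_def nth_append)
qed

lemma level_Un_last:
  assumes "Z \<in> triangles n" "finite S" "card S = Suc n" "below Z S"
  shows "level (Z \<union> S) (Suc n) = S"
proof -
  \<comment> \<open>Positions of \<open>elt\<close> start at 1 and list indices at 0: the
    \<open>Suc\<close> cancels the \<open>- 1\<close>, and the \<open>triangular n\<close> entries
    of \<open>Z\<close> are skipped.\<close>
  have e: "elt (Z \<union> S) (Suc (triangular n + j)) = sorted_list_of_set S ! j" for j
    using assms
    by (simp add: elt_def sorted_list_of_set_Un triangles_def below_def nth_append)
  have "{triangular (Suc n - 1) + 1..triangular (Suc n)}
      = (\<lambda>j. Suc (triangular n + j)) ` {..<Suc n}" (is "?I = ?f ` _")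
  proof (intro equalityI subsetI)
    fix x assume "x \<in> ?I"
    then have "x = ?f (x - triangular n - 1)" "x - triangular n - 1 < Suc n" by auto
    then show "x \<in> ?f ` {..<Suc n}" by blast
  qed auto
  then have "level (Z \<union> S) (Suc n) = (!) (sorted_list_of_set S) ` {..<Suc n}"
    unfolding level_def by (simp add: image_image e)
  also have "\<dots> = set (sorted_list_of_set S)"
    using assms by (auto simp: set_conv_nth)
  finally show ?thesis
    using assms by simp
qed

lemma triangles_Un:
  assumes "Z \<in> triangles n" "finite S" "card S = Suc n" "below Z S"
  shows "Z \<union> S \<in> triangles (Suc n)"
  using assms by (simp add: triangles_def card_Un_disjoint below_disjoint)

lemma levels_Un:
  assumes "Z \<in> triangles n" "finite S" "card S = Suc n" "below Z S"
  shows "levels (Z \<union> S) = insert S (levels Z)"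
proof -
  have "levels (Z \<union> S) = level (Z \<union> S) ` insert (Suc n) {1..n}"
    using levels_eq[OF triangles_Un[OF assms]] by (simp add: atLeastAtMostSuc_conv)
  also have "\<dots> = insert S (level Z ` {1..n})"
    using level_Un_last[OF assms] level_Un_low[OF assms(1,2,4)] by auto
  finally show ?thesis
    using levels_eq[OF assms(1)] by simp
qed

section \<open>Splitting off the last level and induction over levels\<close>

lemma triangles_0 [simp]: "triangles 0 = {{}}"
  by (auto simp: triangles_def)

lemma levels_empty [simp]: "levels {} = {}"
  using levels_eq[of "{}" 0] by simp

lemma split_top:
  assumes "finite (X::nat set)" "card X = a + b"
  obtains Z S where "X = Z \<union> S" "finite Z" "finite S" "card Z = a" "card S = b" "below Z S"
proof -
  define xs where "xs = sorted_list_of_set X"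
  \<comment> \<open>Everything is stated for the concatenation, so that order, distinctness and
    union can afterwards be split at the cut.\<close>
  have xs: "sorted_wrt (<) (take a xs @ drop a xs)" "distinct (take a xs @ drop a xs)"
      "length xs = a + b" "set (take a xs @ drop a xs) = X"
    using assms by (simp_all add: xs_def del: distinct_append set_append sorted_wrt_append)
  show thesis
  proof (rule that)
    show "X = set (take a xs) \<union> set (drop a xs)"
      using xs(4) by (simp del: append_take_drop_id)
    show "below (set (take a xs)) (set (drop a xs))"
      using xs(1) unfolding below_def sorted_wrt_append by blast
    show "card (set (take a xs)) = a" "card (set (drop a xs)) = b"
      using xs(2,3) by (simp_all add: distinct_card)
  qed simp_all
qed

text \<open>Cutting off the largest \<open>Suc n\<close> points leaves a triangle with one level
  fewer. With \<open>levels_Un\<close> this replaces the index arithmetic by the insertion of one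
  new level.\<close>

lemma triangles_induct [consumes 1, case_names empty Un]:
  assumes "X \<in> triangles n"
    and "P 0 {}"
    and "\<And>n Z S. Z \<in> triangles n \<Longrightarrow> finite S \<Longrightarrow> card S = Suc n \<Longrightarrow> below Z S \<Longrightarrow>
           P n Z \<Longrightarrow> P (Suc n) (Z \<union> S)"
  shows "P n X"
  using assms(1)
proof (induction n arbitrary: X)
  case 0
  then show ?case using assms(2) by simp
next
  case (Suc n)
  then have "finite X" "card X = triangular n + Suc n"
    by (simp_all add: triangles_def)
  then obtain Z S where ZS: "X = Z \<union> S" "finite Z" "finite S" "card Z = triangular n"
      "card S = Suc n" "below Z S"
    by (rule split_top)
  then have "Z \<in> triangles n"
    by (simp add: triangles_def)
  with ZS Suc.IH show ?case
    using assms(3) by blast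
qed

section \<open>The levels of a triangle as a partition into nonempty sets\<close>

lemma Union_levels: "X \<in> triangles n \<Longrightarrow> \<Union>(levels X) = X"
  by (induction rule: triangles_induct) (auto simp: levels_Un)

lemma level_nonempty: "X \<in> triangles n \<Longrightarrow> L \<in> levels X \<Longrightarrow> L \<noteq> {}"
  by (induction rule: triangles_induct) (auto simp: levels_Un)

lemma level_not_subset:
  assumes "X \<in> triangles n" "L \<in> levels X" "X \<inter> T = {}"
  shows "\<not> L \<subseteq> T"
proof -
  have "L \<subseteq> X"
    using Union_levels[OF assms(1)] assms(2) by blast
  then show ?thesis
    using level_nonempty[OF assms(1,2)] assms(3) by blast
qed

lemma finite_levels: "X \<in> triangles n \<Longrightarrow> finite (levels X)"
  by (simp add: levels_eq)

lemma card_levels: "X \<in> triangles n \<Longrightarrow> card (levels X) = n"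
proof (induction rule: triangles_induct)
  case (Un n Z S)
  have "S \<noteq> {}"
    using Un(3) by auto
  then have "S \<notin> levels Z"
    using Union_levels[OF Un(1)] below_disjoint[OF Un(4)] by blast
  then show ?case
    using Un finite_levels[OF Un(1)] by (simp add: levels_Un)
qed simp

lemma level_unique:
  assumes "X \<in> triangles n" "L \<in> levels X" "M \<in> levels X" "x \<in> L" "x \<in> M"
  shows "L = M"
  using assms
proof (induction rule: triangles_induct)
  case (Un n Z S)
  have "K \<inter> S = {}" if "K \<in> levels Z" for K
    using that Union_levels[OF Un(1)] below_disjoint[OF Un(4)] by auto
  then show ?case
    using Un by (auto simp: levels_Un)
qed simp

section \<open>Triangles inside a larger triangle\<close>

lemma triangles_in_0 [simp]: "triangles_in 0 B = {{}}"
  by (auto simp: triangles_in_def tri_le_def)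

text \<open>A one-point set has itself as its only level, so the distinctness clause of
  \<open>tri_le\<close> is vacuous. This identifies games for \<open>k = 1\<close> with colourings
  of points.\<close>

lemma triangles_in_1:
  assumes "B \<in> triangles m"
  shows "triangles_in 1 B = (\<lambda>x. {x}) ` B"
proof -
  have "levels {x} = {{x}}" for x
    using levels_Un[of "{}" 0 "{x}"] by (simp add: below_def)
  then have "tri_le {x} B" if "x \<in> B" for x
    using that Union_levels[OF assms] by (auto simp: tri_le_def)
  moreover have "triangles 1 = range (\<lambda>x. {x})"
    by (auto simp: triangles_def card_1_singleton_iff)
  moreover have "x \<in> B" if "tri_le {x} B" for x
    using that by (simp add: tri_le_def)
  ultimately show ?thesis
    unfolding triangles_in_def by auto
qed

text \<open>\<open>Z\<close> misses \<open>T\<close> and its levels are nonempty, so the new level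
  \<open>T\<close> can contain none of them and the comparison with \<open>B\<close>
  persists.\<close>

lemma triangles_in_Un_mono:
  assumes "B \<in> triangles n" "finite T" "card T = Suc n" "below B T" "Z \<in> triangles_in p B"
  shows "Z \<in> triangles_in p (B \<union> T)"
proof -
  have Z: "Z \<in> triangles p" "tri_le Z B"
    using assms(5) by (auto simp: triangles_in_def)
  have "Z \<subseteq> B"
    using Z(2) by (simp add: tri_le_def)
  then have "\<not> L \<subseteq> T" if "L \<in> levels Z" for L
    using level_not_subset[OF Z(1) that, of T] below_disjoint[OF assms(4)] by blast
  then have low: "M \<in> levels B" if "L \<in> levels Z" "M \<in> levels (B \<union> T)" "L \<subseteq> M" for L M
    using that levels_Un[OF assms(1-4)] by auto
  have "tri_le Z (B \<union> T)"
    unfolding tri_le_def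
  proof (intro conjI ballI impI)
    show "Z \<subseteq> B \<union> T"
      using \<open>Z \<subseteq> B\<close> by blast
  next
    fix L assume "L \<in> levels Z"
    then show "\<exists>M\<in>levels (B \<union> T). L \<subseteq> M"
      using Z(2) levels_Un[OF assms(1-4)] by (auto simp: tri_le_def)
  next
    fix L L' M M'
    assume "L \<in> levels Z" "L' \<in> levels Z" "M \<in> levels (B \<union> T)" "M' \<in> levels (B \<union> T)"
      and "L \<noteq> L'" "L \<subseteq> M" "L' \<subseteq> M'"
    then show "M \<noteq> M'"
      using low Z(2) unfolding tri_le_def by metis
  qed
  then show ?thesis
    using Z(1) by (simp add: triangles_in_def)
qed

text \<open>The new level \<open>S\<close> goes into \<open>T\<close>, while the levels of
  \<open>Z\<close> keep their places in \<open>B\<close>.\<close>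

lemma triangles_in_Un:
  assumes "B \<in> triangles n" "finite T" "card T = Suc n" "below B T" "Z \<in> triangles_in p B"
    and "S \<subseteq> T" "card S = Suc p"
  shows "Z \<union> S \<in> triangles_in (Suc p) (B \<union> T)"
proof -
  have Z: "Z \<in> triangles p" "tri_le Z B"
    using assms(5) by (auto simp: triangles_in_def)
  have ZB: "Z \<subseteq> B"
    using Z(2) by (simp add: tri_le_def)
  have S: "finite S" "S \<noteq> {}"
    using assms(2,6,7) finite_subset by auto
  have ZS: "below Z S"
    using ZB assms(4,6) unfolding below_def by blast
  note lev = levels_Un[OF assms(1-4)] and levS = levels_Un[OF Z(1) S(1) assms(7) ZS]
  have "\<not> L \<subseteq> T" if "L \<in> levels Z" for L
    using level_not_subset[OF Z(1) that, of T] below_disjoint[OF assms(4)] ZB by blast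
  moreover have "\<not> S \<subseteq> M" if "M \<in> levels B" for M
  proof -
    have "M \<subseteq> B"
      using that Union_levels[OF assms(1)] by blast
    then show ?thesis
      using S(2) assms(6) below_disjoint[OF assms(4)] by blast
  qed
  \<comment> \<open>\<open>T\<close> contains no level of \<open>Z\<close>, and no level of
    \<open>B\<close> contains \<open>S\<close>.\<close>
  ultimately have top: "L = S \<longleftrightarrow> M = T"
    if "L \<in> levels (Z \<union> S)" "M \<in> levels (B \<union> T)" "L \<subseteq> M" for L M
    using that lev levS by auto
  have "tri_le (Z \<union> S) (B \<union> T)"
    unfolding tri_le_def
  proof (intro conjI ballI impI)
    show "Z \<union> S \<subseteq> B \<union> T"
      using ZB assms(6) by blast
  next
    fix L assume "L \<in> levels (Z \<union> S)"
    then show "\<exists>M\<in>levels (B \<union> T). L \<subseteq> M"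
      using Z(2) assms(6) lev levS by (auto simp: tri_le_def)
  next
    fix L L' M M'
    assume L: "L \<in> levels (Z \<union> S)" "L' \<in> levels (Z \<union> S)" "L \<noteq> L'"
      and M: "M \<in> levels (B \<union> T)" "M' \<in> levels (B \<union> T)" "L \<subseteq> M" "L' \<subseteq> M'"
    have iffs: "L = S \<longleftrightarrow> M = T" "L' = S \<longleftrightarrow> M' = T"
      using top L M by auto
    show "M \<noteq> M'"
    proof
      \<comment> \<open>A common level equal to \<open>T\<close> would force both \<open>L\<close>
        and \<open>L'\<close> to be \<open>S\<close>; otherwise everything happens in
        \<open>Z\<close> and \<open>B\<close>.\<close>
      assume "M = M'"
      with iffs L(3) have "L \<noteq> S" "L' \<noteq> S" "M \<noteq> T"
        by auto
      then have "L \<in> levels Z" "L' \<in> levels Z" "M \<in> levels B"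
        using L M lev levS by auto
      with \<open>M = M'\<close> L(3) M(3,4) Z(2) show False
        unfolding tri_le_def by metis
    qed
  qed
  then show ?thesis
    using triangles_Un[OF Z(1) S(1) assms(7) ZS] by (simp add: triangles_in_def)
qed

section \<open>Upper bound: one colour always contains a triangle\<close>

text \<open>The inequality survives removing one level and lowering one of \<open>p\<close>,
  \<open>q\<close> by 1. Allowing the value 0 makes the base case trivial, with \<open>{}\<close> as
  the triangle.\<close>

lemma monochromatic_triangle:
  assumes "B \<in> triangles m" "p + q \<le> Suc m"
  shows "(\<exists>Z\<in>triangles_in p B. Z \<subseteq> R) \<or> (\<exists>Z\<in>triangles_in q B. Z \<subseteq> - R)"
  using assms
proof (induction arbitrary: p q rule: triangles_induct)
  case empty
  then have "p = 0 \<or> q = 0" by auto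
  then show ?case by auto
next
  case (Un n B T)
  note grow = triangles_in_Un[OF Un.hyps(1-4)] and mono = triangles_in_Un_mono[OF Un.hyps(1-4)]
  show ?case
  proof (cases "p = 0 \<or> q = 0")
    case True
    then show ?thesis by auto
  next
    case False
    then obtain p' q' where pq: "p = Suc p'" "q = Suc q'"
      by (metis not0_implies_Suc)
    have "card T = card (T \<inter> R) + card (T \<inter> - R)"
      using Un.hyps(2) card_Un_disjoint[of "T \<inter> R" "T \<inter> - R"]
      by (simp add: Int_Un_distrib[symmetric] disjoint_iff)
    \<comment> \<open>Otherwise \<open>T\<close> would have at most \<open>p + q - 2\<close>, hence
      at most \<open>n\<close>, points.\<close>
    then consider "p \<le> card (T \<inter> R)" | "q \<le> card (T \<inter> - R)"
      using Un.hyps(3) Un.prems pq by linarith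
    then show ?thesis
    proof cases
      case 1
      then obtain S where S: "S \<subseteq> T \<inter> R" "card S = Suc p'"
        using obtain_subset_with_card_n pq(1) by metis
      \<comment> \<open>Only the target whose last level was just found is lowered: a triangle in
        \<open>R\<close> is completed by \<open>S\<close>, one in the complement already has full
        size.\<close>
      have "(\<exists>Z\<in>triangles_in p' B. Z \<subseteq> R) \<or> (\<exists>Z\<in>triangles_in q B. Z \<subseteq> - R)"
        using Un.IH[of p' q] Un.prems pq by simp
      then show ?thesis
      proof (elim disjE bexE)
        fix Z assume "Z \<in> triangles_in p' B" "Z \<subseteq> R"
        with S grow[of Z p' S] have "Z \<union> S \<in> triangles_in p (B \<union> T)" "Z \<union> S \<subseteq> R"
          using pq by auto
        then show ?thesis by blast
      qed (use mono in blast)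
    next
      case 2
      then obtain S where S: "S \<subseteq> T \<inter> - R" "card S = Suc q'"
        using obtain_subset_with_card_n pq(2) by metis
      have "(\<exists>Z\<in>triangles_in p B. Z \<subseteq> R) \<or> (\<exists>Z\<in>triangles_in q' B. Z \<subseteq> - R)"
        using Un.IH[of p q'] Un.prems pq by simp
      then show ?thesis
      proof (elim disjE bexE)
        fix Z assume "Z \<in> triangles_in q' B" "Z \<subseteq> - R"
        with S grow[of Z q' S] have "Z \<union> S \<in> triangles_in q (B \<union> T)" "Z \<union> S \<subseteq> - R"
          using pq by auto
        then show ?thesis by blast
      qed (use mono in blast)
    qed
  qed
qed

section \<open>Lower bound: few levels contain no large triangle\<close>

text \<open>Sending each level of \<open>Z\<close> to the level of \<open>B\<close> around it is
  injective by \<open>tri_le\<close>. The image lies in \<open>D\<close>, since a point of the level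
  also lies in a member of \<open>D\<close> and levels of \<open>B\<close> are disjoint.\<close>

lemma triangle_needs_levels:
  assumes B: "B \<in> triangles m" and D: "D \<subseteq> levels B"
    and Z: "Z \<in> triangles_in n B" "Z \<subseteq> \<Union>D"
  shows "n \<le> card D"
proof -
  have Zn: "Z \<in> triangles n" "tri_le Z B"
    using Z by (auto simp: triangles_in_def)
  then obtain f where f: "\<And>L. L \<in> levels Z \<Longrightarrow> f L \<in> levels B \<and> L \<subseteq> f L"
    unfolding tri_le_def by metis
  have "inj_on f (levels Z)"
    using f Zn(2) unfolding tri_le_def inj_on_def by metis
  moreover have "f L \<in> D" if L: "L \<in> levels Z" for L
  proof -
    obtain x where x: "x \<in> L"
      using level_nonempty[OF Zn(1) L] by blast
    then have "x \<in> Z"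
      using L Union_levels[OF Zn(1)] by blast
    then obtain M where "M \<in> D" "x \<in> M"
      using Z(2) by blast
    moreover have "f L = M"
      using level_unique[OF B] f[OF L] x D \<open>M \<in> D\<close> \<open>x \<in> M\<close> by blast
    ultimately show ?thesis
      by simp
  qed
  ultimately have "card (levels Z) \<le> card D"
    using card_inj_on_le[of f "levels Z" D] finite_subset[OF D finite_levels[OF B]] by blast
  then show ?thesis
    using card_levels[OF Zn(1)] by simp
qed

section \<open>From colourings of points to completed games\<close>

lemma triangles_in_triangles: "B \<in> triangles m \<Longrightarrow> Z \<in> triangles_in p B \<Longrightarrow> Z \<in> triangles p"
  by (simp add: triangles_in_def)

lemma win_iff_subset:
  assumes "B \<in> triangles m"
  shows "(\<exists>Z\<in>triangles_in p B. triangles_in 1 Z \<subseteq> (\<lambda>x. {x}) ` R)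
    \<longleftrightarrow> (\<exists>Z\<in>triangles_in p B. Z \<subseteq> R)"
proof -
  have "triangles_in 1 Z \<subseteq> (\<lambda>x. {x}) ` R \<longleftrightarrow> Z \<subseteq> R" if "Z \<in> triangles_in p B" for Z
    using triangles_in_1[OF triangles_in_triangles[OF assms that]] by auto
  then show ?thesis by blast
qed

lemma no_draw:
  assumes "completed_game m 1 B X Y" "p + q \<le> Suc m"
  shows "\<not> draw p q 1 B X Y"
proof -
  define R where "R = {x. {x} \<in> X}"
  have B: "B \<in> triangles m" and XY: "X \<union> Y = (\<lambda>x. {x}) ` B" "X \<inter> Y = {}"
    using assms(1) triangles_in_1 unfolding completed_game_def by auto
  have sub: "X \<subseteq> (\<lambda>x. {x}) ` B" "Y \<subseteq> (\<lambda>x. {x}) ` B"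
    using XY(1) by auto
  have X: "X = (\<lambda>x. {x}) ` R"
    using sub(1) by (auto simp: R_def)
  have "{x} \<in> Y \<longleftrightarrow> x \<in> B - R" for x
    using XY by (auto simp: R_def)
  then have Y: "Y = (\<lambda>x. {x}) ` (B - R)"
    using sub(2) by auto
  \<comment> \<open>The colouring lemma uses the full complement of \<open>R\<close>, the game only
    its part in \<open>B\<close>.\<close>
  have "Z \<subseteq> B - R" if "Z \<in> triangles_in q B" "Z \<subseteq> - R" for Z
    using that by (auto simp: triangles_in_def tri_le_def)
  then show ?thesis
    using monochromatic_triangle[OF B assms(2), of R]
    unfolding draw_def win_one_def win_two_def X Y win_iff_subset[OF B] by blast
qed

lemma exists_draw:
  assumes "1 \<le> p" "p \<le> m" "m + 1 < p + q"
  shows "\<exists>B X Y. completed_game m 1 B X Y \<and> draw p q 1 B X Y"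
proof -
  define B where "B = {..<triangular m}"
  have B: "B \<in> triangles m"
    by (simp add: B_def triangles_def)
  have "p - 1 \<le> card (levels B)"
    using card_levels[OF B] assms by simp
  then obtain D where D: "D \<subseteq> levels B" "card D = p - 1" "finite D"
    by (rule obtain_subset_with_card_n)
  \<comment> \<open>There remain \<open>m - (p - 1)\<close> levels, fewer than \<open>q\<close>
    because \<open>m + 1 < p + q\<close>.\<close>
  have E: "card (levels B - D) < q"
    using D card_levels[OF B] assms by (simp add: card_Diff_subset)
  define R S where "R = \<Union>D" and "S = \<Union>(levels B - D)"
  have "R \<union> S = B"
    using D(1) Union_levels[OF B] unfolding R_def S_def by blast
  moreover have "R \<inter> S = {}"
    using D(1) level_unique[OF B] unfolding R_def S_def by blast
  ultimately have "completed_game m 1 B ((\<lambda>x. {x}) ` R) ((\<lambda>x. {x}) ` S)"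
    unfolding completed_game_def triangles_in_1[OF B] using B by auto
  moreover have "\<not> Z \<subseteq> R" if "Z \<in> triangles_in p B" for Z
    using triangle_needs_levels[OF B D(1) that] D(2) assms(1) unfolding R_def by linarith
  moreover have "\<not> Z \<subseteq> S" if "Z \<in> triangles_in q B" for Z
    using triangle_needs_levels[OF B Diff_subset that] E unfolding S_def by fastforce
  ultimately have "completed_game m 1 B ((\<lambda>x. {x}) ` R) ((\<lambda>x. {x}) ` S) \<and>
      draw p q 1 B ((\<lambda>x. {x}) ` R) ((\<lambda>x. {x}) ` S)"
    unfolding draw_def win_one_def win_two_def win_iff_subset[OF B] by simp
  then show ?thesis by blast
qed

lemma tri_ramsey_1:
  assumes "1 \<le> p" "1 \<le> q"
  shows "tri_ramsey p q 1 = p + q - 1"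
  unfolding tri_ramsey_def
proof (rule Least_equality)
  show "max p q \<le> p + q - 1 \<and>
      (\<forall>B X Y. completed_game (p + q - 1) 1 B X Y \<longrightarrow> \<not> draw p q 1 B X Y)"
    using assms no_draw by auto
next
  fix m
  assume "max p q \<le> m \<and> (\<forall>B X Y. completed_game m 1 B X Y \<longrightarrow> \<not> draw p q 1 B X Y)"
  \<comment> \<open>A smaller \<open>m\<close> would satisfy \<open>m + 1 < p + q\<close>, and
    \<open>p \<le> m\<close> comes from the maximum, so a draw would exist.\<close>
  then show "p + q - 1 \<le> m"
    using exists_draw[of p m q] assms by fastforce
qed

theorem theorem6:
  "(\<forall>p q. 1 \<le> p \<and> 1 \<le> q \<longrightarrow> tri_ramsey p q 1 = p + q - 1) \<and>
   (\<forall>n\<ge>1. tri_ramsey_diag n 1 = 2 * n - 1)"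
  \<comment> \<open>\<open>simplified\<close> turns the literal 1 into \<open>Suc 0\<close>, the
    form in which the simplifier meets it in the goal.\<close>
  by (simp add: tri_ramsey_1[simplified] tri_ramsey_diag_def mult_2)

end
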